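(* There exists a universal constant $\tilde a>0$ (not depending on $n$, $r$, $c$ or $k$) such that the following holds. Let $n\ge 3$ and $r$ be integers with $1\le r\le n/2$, let $c\ge 0$, and suppose that $$k=\min\left\{\tfrac14 n(\log n-c),\ (n-2)\log\Big(\frac{n}{n-2r}\Big)+\tfrac12(n-2)\log\Big[1+\tfrac14(n-2)\Big(1-\Big(\frac{n-2r}{n}\Big)^2\Big)e^{-c}\Big]\right\}$$ is a nonnegative integer, where $\log(n/0)$ is interpreted as $+\infty$ when $r=n/2$. Let $Q$ be the probability measure on $S_n$ defined in the context, let $\widetilde{Q^{*k}}$ be the probability measure on $X=S_n/(S_r\times S_{n-r})$ induced by the $k$-fold convolution $Q^{*k}$, and let $\widetilde U$ be the uniform probability measure on $X$. Then $$\tfrac12\binom nr^{1/2}\|\widetilde{Q^{*k}}-\widetilde U\|_2\ \ge\ \|\widetilde{Q^{*k}}-\widetilde U\|_{\mathrm{TV}}\ \ge\ 1-\tilde a e^{-c}.$$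
   Context: Let $K\cong S_r\times S_{n-r}$ be the subgroup of $S_n$ of permutations mapping $\{1,\dots,r\}$ to itself and $\{r+1,\dots,n\}$ to itself. Let $T_2$ be the set of all transpositions in $S_n\setminus K$ (there are $r(n-r)$ of them), and $T_2K=\{\tau\kappa:\tau\in T_2,\ \kappa\in K\}$; each element of $T_2K$ is uniquely of the form $\tau\kappa$, and $T_2K\cap K=\emptyset$. The probability measure $Q$ on $S_n$ is $$Q(\kappa)=\frac{n^2-2r(n-r)}{n^2\,r!(n-r)!}\ (\kappa\in K),\qquad Q(\tau\kappa)=\frac{2}{n^2\,r!(n-r)!}\ (\tau\kappa\in T_2K),\qquad Q(\pi)=0\ \text{otherwise.}$$ $X=S_n/K$ is the set of left cosets of $K$. A probability measure $R$ on $S_n$ induces $\widetilde R$ on $X$ by $\widetilde R(xK)=R(xK)=\sum_{\kappa\in K}R(x\kappa)$. Convolution: $(R_1*R_2)(g)=\sum_h R_1(gh^{-1})R_2(h)$; $Q^{*k}$ is the convolution of $Q$ with itself $k$ times ($Q^{*0}$ is the point mass at the identity). $\widetilde U(x)=1/\binom nr$ for every $x\in X$. For probability measures $\mu,\nu$ on $X$: $\|\mu-\nu\|_{\mathrm{TV}}=\frac12\sum_{x\in X}|\mu(x)-\nu(x)|$ and $\|\mu-\nu\|_2=\big(\sum_{x\in X}|\mu(x)-\nu(x)|^2\big)^{1/2}$ (unnormalized). $\log$ is the natural logarithm. *)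

theory Defs
  imports
    "HOL-Algebra.Sym_Groups"
    "HOL-Algebra.Left_Coset"
    "HOL-Library.Extended_Real"
begin

section \<open>Measures on a finite group and on its left cosets\<close>

text \<open>A measure on a finite set is represented by its real-valued mass function.\<close>

definition convolution ::
  "('a, 'b) monoid_scheme \<Rightarrow> ('a \<Rightarrow> real) \<Rightarrow> ('a \<Rightarrow> real) \<Rightarrow> 'a \<Rightarrow> real"
  where "convolution G R\<^sub>1 R\<^sub>2 g =
    (\<Sum>h\<in>carrier G. R\<^sub>1 (g \<otimes>\<^bsub>G\<^esub> inv\<^bsub>G\<^esub> h) * R\<^sub>2 h)"

primrec convolution_power ::
  "('a, 'b) monoid_scheme \<Rightarrow> ('a \<Rightarrow> real) \<Rightarrow> nat \<Rightarrow> 'a \<Rightarrow> real"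
  where
    "convolution_power G R 0 = (\<lambda>g. if g = \<one>\<^bsub>G\<^esub> then 1 else 0)"
  | "convolution_power G R (Suc k) = convolution G R (convolution_power G R k)"

text \<open>A left coset is itself a set of group elements, so the induced measure evaluates a
  coset by summing the masses of its elements.\<close>

definition induced_measure :: "('a \<Rightarrow> real) \<Rightarrow> 'a set \<Rightarrow> real"
  where "induced_measure R C = (\<Sum>g\<in>C. R g)"

definition tv_dist :: "'a set \<Rightarrow> ('a \<Rightarrow> real) \<Rightarrow> ('a \<Rightarrow> real) \<Rightarrow> real"
  where "tv_dist X \<mu> \<nu> = (1/2) * (\<Sum>x\<in>X. \<bar>\<mu> x - \<nu> x\<bar>)"

text \<open>The sum of squares carries no normalizing factor.\<close>

definition l2_dist :: "'a set \<Rightarrow> ('a \<Rightarrow> real) \<Rightarrow> ('a \<Rightarrow> real) \<Rightarrow> real"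
  where "l2_dist X \<mu> \<nu> = sqrt (\<Sum>x\<in>X. \<bar>\<mu> x - \<nu> x\<bar>\<^sup>2)"

section \<open>The random walk\<close>

definition young_subgroup :: "nat \<Rightarrow> nat \<Rightarrow> (nat \<Rightarrow> nat) set"
  where "young_subgroup n r =
    {p \<in> carrier (sym_group n). p ` {1..r} = {1..r} \<and> p ` {r+1..n} = {r+1..n}}"

definition outer_transpositions :: "nat \<Rightarrow> nat \<Rightarrow> (nat \<Rightarrow> nat) set"
  where "outer_transpositions n r =
    {transpose i j | i j. i \<in> {1..n} \<and> j \<in> {1..n} \<and> i \<noteq> j} - young_subgroup n r"

definition walk_step :: "nat \<Rightarrow> nat \<Rightarrow> (nat \<Rightarrow> nat) \<Rightarrow> real"
  where "walk_step n r p =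
    (if p \<in> young_subgroup n r then
       ((real n)\<^sup>2 - 2 * real r * (real n - real r)) / ((real n)\<^sup>2 * fact r * fact (n - r))
     else if p \<in> outer_transpositions n r <#>\<^bsub>sym_group n\<^esub> young_subgroup n r then
       2 / ((real n)\<^sup>2 * fact r * fact (n - r))
     else 0)"

definition coset_space :: "nat \<Rightarrow> nat \<Rightarrow> (nat \<Rightarrow> nat) set set"
  where "coset_space n r = lcosets\<^bsub>sym_group n\<^esub> (young_subgroup n r)"

definition walk_distribution :: "nat \<Rightarrow> nat \<Rightarrow> nat \<Rightarrow> (nat \<Rightarrow> nat) set \<Rightarrow> real"
  where "walk_distribution n r k =
    induced_measure (convolution_power (sym_group n) (walk_step n r) k)"

definition coset_uniform :: "nat \<Rightarrow> nat \<Rightarrow> (nat \<Rightarrow> nat) set \<Rightarrow> real"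
  where "coset_uniform n r = (\<lambda>_. 1 / real (n choose r))"

section \<open>The number of steps\<close>

text \<open>The logarithm of \<open>n / (n - 2 * r)\<close>, for \<open>2 * r \<le> n\<close>, with \<open>ln (n / 0)\<close> read as \<open>\<infinity>\<close>.\<close>

definition log_ratio :: "nat \<Rightarrow> nat \<Rightarrow> ereal"
  where "log_ratio n r =
    (if 2 * r = n then \<infinity> else ereal (ln (real n / (real n - 2 * real r))))"

definition step_count :: "nat \<Rightarrow> nat \<Rightarrow> real \<Rightarrow> ereal"
  where "step_count n r c = min
    (ereal ((1/4) * real n * (ln (real n) - c)))
    (ereal (real n - 2) * log_ratio n r +
     ereal ((1/2) * (real n - 2) *
       ln (1 + (1/4) * (real n - 2) * (1 - ((real n - 2 * real r) / real n)\<^sup>2) * exp (- c))))"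

end

theory Submission
  imports Defs "HOL-Analysis.Convex"
begin

text \<open>
  The upper bound on total variation distance is the Cauchy-Schwarz inequality, since there are
  \<open>n choose r\<close> cosets. The lower bound is a second moment argument.

  A coset \<open>gK\<close> is determined by the set \<open>g{1..r}\<close>, and the test statistic depends only on the number
  \<open>x\<close> of points of \<open>{1..r}\<close> in this set. A step of the walk moves \<open>x\<close> by at most one, because
  elements of \<open>K\<close> preserve \<open>x\<close> and a transposition outside \<open>K\<close> exchanges one point of \<open>{1..r}\<close> for
  one outside. Averaging over all such transpositions gives an explicit birth-and-death step
  (\<open>walk_step_average\<close>). It has an affine eigenfunction \<open>f\<close>, normalized to be 1 at the start, with
  eigenvalue \<open>L = 1 - 2/n\<close>. Moreover \<open>f\<^sup>2\<close> is mapped to \<open>L\<^sup>2 f\<^sup>2 + (4/n\<^sup>2)(\<beta> f + 1)\<close> with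
  \<open>\<beta> = (n - 2r)\<^sup>2 / (2r(n - r))\<close>; that the coefficient of \<open>f\<^sup>2\<close> is exactly \<open>L\<^sup>2\<close> is what
  keeps the variance under control. Hence, with \<open>q = L\<^sup>k\<close>, after \<open>k\<close> steps \<open>f\<close> has mean \<open>q\<close> and variance
  \<open>(1 - q\<^sup>2)/(n - 1) + 2\<beta>(q - q\<^sup>2)/(n - 2)\<close> (\<open>walk_mean_eigenfunction_squared\<close>). The uniform
  distribution is stationary for the walk, so the same two identities show that under it \<open>f\<close> has mean 0
  and variance \<open>1/(n - 1)\<close>.

  Chebyshev's inequality on both sides of the threshold \<open>q/2\<close> bounds the distance from below by 1 minus
  \<open>4/q\<^sup>2\<close> times the sum of the two variances. The two expressions in the minimum that defines \<open>k\<close>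
  control the two parts of this error: \<open>k \<le> n (log n - c)/4\<close> makes \<open>1/(n q\<^sup>2)\<close> of order \<open>e\<^sup>-\<^sup>c\<close>,
  and the other bound on \<open>k\<close> does the same for \<open>\<beta>(1/q - 1)/n\<close>.
\<close>

section \<open>Total variation distance on a finite set\<close>

lemma tv_dist_le_l2_dist:
  assumes "finite X"
  shows "tv_dist X \<mu> \<nu> \<le> (1/2) * sqrt (real (card X)) * l2_dist X \<mu> \<nu>"
proof -
  have "(\<Sum>x\<in>X. \<bar>\<mu> x - \<nu> x\<bar>)\<^sup>2 \<le> (\<Sum>x\<in>X. \<bar>\<mu> x - \<nu> x\<bar>\<^sup>2) * real (card X)"
    using sum_squared_le_sum_of_squares[of "\<lambda>x. \<bar>\<mu> x - \<nu> x\<bar>" X] assms by simp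
  then have "(\<Sum>x\<in>X. \<bar>\<mu> x - \<nu> x\<bar>) \<le> sqrt (real (card X) * (\<Sum>x\<in>X. \<bar>\<mu> x - \<nu> x\<bar>\<^sup>2))"
    by (intro real_le_rsqrt) (simp add: mult.commute)
  then show ?thesis
    by (simp add: tv_dist_def l2_dist_def real_sqrt_mult)
qed

lemma tv_dist_ge_event:
  assumes "finite X" "B \<subseteq> X" "sum \<mu> X = 1" "sum \<nu> X = 1"
  shows "sum \<mu> B - sum \<nu> B \<le> tv_dist X \<mu> \<nu>"
proof -
  have split: "sum f X = sum f B + sum f (X - B)" for f :: "'a \<Rightarrow> real"
    using assms(1,2) by (simp add: sum.subset_diff)
  \<comment> \<open>Both total masses are 1, so the excess on the event equals the deficit on its complement.\<close>
  have "sum \<mu> B - sum \<nu> B \<le> (\<Sum>x\<in>B. \<bar>\<mu> x - \<nu> x\<bar>)"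
    unfolding sum_subtractf[symmetric] by (rule sum_mono) simp
  moreover have "sum \<nu> (X - B) - sum \<mu> (X - B) \<le> (\<Sum>x\<in>X - B. \<bar>\<mu> x - \<nu> x\<bar>)"
    unfolding sum_subtractf[symmetric] by (rule sum_mono) simp
  ultimately show ?thesis
    using split[of \<mu>] split[of \<nu>] split[of "\<lambda>x. \<bar>\<mu> x - \<nu> x\<bar>"] assms(3,4)
    unfolding tv_dist_def by argo
qed

section \<open>Measures on a finite group and its left cosets\<close>

text \<open>Convolution with \<open>R\<close> from the left is one more independent step drawn from \<open>R\<close>, multiplied on the
  left: the integral of \<open>F\<close> against it is the integral of the one-step average of \<open>F\<close>.\<close>

lemma (in group) sum_convolution:
  "(\<Sum>g\<in>carrier G. convolution G R S g * F g) =
         (\<Sum>h\<in>carrier G. S h * (\<Sum>s\<in>carrier G. R s * F (s \<otimes> h)))"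
proof -
  have inner: "(\<Sum>g\<in>carrier G. R (g \<otimes> inv h) * F g) = (\<Sum>s\<in>carrier G. R s * F (s \<otimes> h))"
    if h: "h \<in> carrier G" for h
    by (rule sum.reindex_bij_witness[of _ "\<lambda>s. s \<otimes> h" "\<lambda>g. g \<otimes> inv h"])
      (use h in \<open>auto simp: m_assoc\<close>)
  have "(\<Sum>g\<in>carrier G. convolution G R S g * F g) =
        (\<Sum>g\<in>carrier G. \<Sum>h\<in>carrier G. S h * (R (g \<otimes> inv h) * F g))"
    unfolding convolution_def by (simp add: sum_distrib_left sum_distrib_right mult_ac)
  also have "\<dots> = (\<Sum>h\<in>carrier G. \<Sum>g\<in>carrier G. S h * (R (g \<otimes> inv h) * F g))"
    by (rule sum.swap)
  also have "\<dots> = (\<Sum>h\<in>carrier G. S h * (\<Sum>g\<in>carrier G. R (g \<otimes> inv h) * F g))"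
    by (simp add: sum_distrib_left)
  finally show ?thesis using inner by simp
qed

lemma (in group) sum_translate:
  assumes "s \<in> carrier G"
  shows "(\<Sum>h\<in>carrier G. F (s \<otimes> h)) = (\<Sum>g\<in>carrier G. F g)"
  by (rule sum.reindex_bij_witness[of _ "\<lambda>g. inv s \<otimes> g" "\<lambda>h. s \<otimes> h"])
    (use assms in \<open>simp_all add: inv_solve_left m_assoc[symmetric]\<close>)

lemma convolution_power_nonneg:
  assumes "\<And>g. R g \<ge> 0"
  shows "g \<in> carrier G \<Longrightarrow> convolution_power G R k g \<ge> 0"
proof (induction k arbitrary: g)
  case (Suc k)
  then show ?case
    unfolding convolution_power.simps convolution_def
    by (intro sum_nonneg mult_nonneg_nonneg assms)
qed simp

lemma (in group) sum_induced_measure: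
  assumes "finite (carrier G)" "subgroup H G" "B \<subseteq> lcosets H"
  shows "(\<Sum>C\<in>B. induced_measure R C) = (\<Sum>g\<in>\<Union>B. R g)"
proof -
  have "\<And>C. C \<in> B \<Longrightarrow> finite C"
    using lcosets_part_G[OF assms(2)] assms(1,3) by (metis Union_upper finite_subset subset_iff)
  moreover have "\<forall>C\<in>B. \<forall>D\<in>B. C \<noteq> D \<longrightarrow> C \<inter> D = {}"
    using lcos_disjoint[OF assms(2)] assms(3) by blast
  ultimately show ?thesis
    unfolding induced_measure_def by (simp add: sum.Union_disjoint)
qed

text \<open>The event that \<open>F > m/2\<close> is a union of cosets, because \<open>F\<close> is constant on cosets. By Chebyshev's
  inequality, its complement is unlikely under \<open>M\<close>, where \<open>F\<close> is concentrated near \<open>m\<close>, and the event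
  itself is unlikely under \<open>N\<close>, where \<open>F\<close> is concentrated near 0.\<close>

lemma (in group) tv_dist_second_moment:
  assumes fin: "finite (carrier G)" and H: "subgroup H G"
    and M: "\<And>g. g \<in> carrier G \<Longrightarrow> M g \<ge> 0" "sum M (carrier G) = 1"
    and N: "\<And>g. g \<in> carrier G \<Longrightarrow> N g \<ge> 0" "sum N (carrier G) = 1"
    and inv: "\<And>g h. g \<in> carrier G \<Longrightarrow> h \<in> H \<Longrightarrow> F (g \<otimes> h) = F g"
    and m: "(m::real) > 0"
  shows "1 - 4 / m\<^sup>2 * ((\<Sum>g\<in>carrier G. M g * (F g - m)\<^sup>2) + (\<Sum>g\<in>carrier G. N g * (F g)\<^sup>2))
         \<le> tv_dist (lcosets H) (induced_measure M) (induced_measure N)"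
proof -
  let ?X = "lcosets H"
  define B where "B = {C \<in> ?X. \<exists>g\<in>C. F g > m / 2}"
  define E where "E = {g \<in> carrier G. F g > m / 2}"
  have X: "\<Union>?X = carrier G" by (rule lcosets_part_G[OF H])
  have finX: "finite ?X" using fin X by (metis finite_UnionD)
  have "\<Union>B = E"
  proof
    show "\<Union>B \<subseteq> E"
    proof
      fix g assume "g \<in> \<Union>B"
      then obtain C g' where C: "C \<in> ?X" "g \<in> C" "g' \<in> C" "F g' > m / 2"
        by (auto simp: B_def)
      then obtain a where a: "a \<in> carrier G" "C = a <# H" by (auto simp: LCOSETS_def)
      then have "F g = F a" "F g' = F a" using C inv by (auto simp: l_coset_def)
      then show "g \<in> E" using C X by (auto simp: E_def)
    qed
    show "E \<subseteq> \<Union>B" using X by (auto simp: E_def B_def)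
  qed
  then have event: "(\<Sum>C\<in>B. induced_measure R C) = sum R E" for R :: "'a \<Rightarrow> real"
    using sum_induced_measure[OF fin H, of B R] by (auto simp: B_def)
  have total: "(\<Sum>C\<in>?X. induced_measure R C) = sum R (carrier G)" for R :: "'a \<Rightarrow> real"
    using sum_induced_measure[OF fin H, of ?X R] X by auto
  have Esub: "E \<subseteq> carrier G" by (auto simp: E_def)
  have sq: "4 / m\<^sup>2 * x\<^sup>2 \<ge> 1" if "\<bar>x\<bar> \<ge> m / 2" for x
  proof -
    have "(m/2)\<^sup>2 \<le> x\<^sup>2" using that m by (simp add: abs_le_square_iff[symmetric])
    then show ?thesis using m by (simp add: field_simps power2_eq_square)
  qed
  have "sum M (carrier G - E) \<le> (\<Sum>g\<in>carrier G - E. M g * (4 / m\<^sup>2 * (F g - m)\<^sup>2))"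
  proof (rule sum_mono)
    fix g assume g: "g \<in> carrier G - E"
    then have "\<bar>F g - m\<bar> \<ge> m / 2" using m by (auto simp: E_def abs_real_def)
    then show "M g \<le> M g * (4 / m\<^sup>2 * (F g - m)\<^sup>2)"
      using mult_left_mono[OF sq M(1), of "F g - m" g] g by simp
  qed
  also have "\<dots> \<le> (\<Sum>g\<in>carrier G. M g * (4 / m\<^sup>2 * (F g - m)\<^sup>2))"
    by (rule sum_mono2) (use fin M in auto)
  finally have 1: "sum M (carrier G - E) \<le> 4 / m\<^sup>2 * (\<Sum>g\<in>carrier G. M g * (F g - m)\<^sup>2)"
    by (simp add: sum_distrib_left mult_ac)
  have "sum N E \<le> (\<Sum>g\<in>E. N g * (4 / m\<^sup>2 * (F g)\<^sup>2))"
  proof (rule sum_mono)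
    fix g assume g: "g \<in> E"
    then have "\<bar>F g\<bar> \<ge> m / 2" by (auto simp: E_def)
    then show "N g \<le> N g * (4 / m\<^sup>2 * (F g)\<^sup>2)"
      using mult_left_mono[OF sq N(1), of "F g" g] g Esub by auto
  qed
  also have "\<dots> \<le> (\<Sum>g\<in>carrier G. N g * (4 / m\<^sup>2 * (F g)\<^sup>2))"
    by (rule sum_mono2) (use fin N Esub in auto)
  finally have 2: "sum N E \<le> 4 / m\<^sup>2 * (\<Sum>g\<in>carrier G. N g * (F g)\<^sup>2)"
    by (simp add: sum_distrib_left mult_ac)
  have "sum M E = 1 - sum M (carrier G - E)"
    using sum.subset_diff[OF Esub fin, of M] M(2) by simp
  moreover have "sum M E - sum N E \<le> tv_dist ?X (induced_measure M) (induced_measure N)"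
    using tv_dist_ge_event[OF finX, of B "induced_measure M" "induced_measure N"] M(2) N(2)
    by (simp add: event total) (simp add: B_def)
  ultimately show ?thesis using 1 2 unfolding distrib_left by linarith
qed

section \<open>The subgroup preserving a block\<close>

text \<open>This count identifies the double coset of the permutation with respect to \<open>young_subgroup n r\<close>. It
  is the only feature of the walk that the test statistic uses.\<close>

definition overlap :: "nat \<Rightarrow> (nat \<Rightarrow> nat) \<Rightarrow> nat"
  where "overlap r g = card (g ` {1..r} \<inter> {1..r})"

lemma finite_sym_group: "finite (carrier (sym_group n))"
  by (simp add: sym_group_def finite_permutations)

lemma young_subgroup_iff:
  "p \<in> young_subgroup n r \<longleftrightarrow>
    p permutes {1..n} \<and> p ` {1..r} = {1..r} \<and> p ` {r+1..n} = {r+1..n}"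
  by (simp add: young_subgroup_def sym_group_carrier)

lemma subgroup_young_subgroup: "subgroup (young_subgroup n r) (sym_group n)"
proof (rule group.subgroupI[OF sym_group_is_group])
  show "young_subgroup n r \<noteq> {}"
  proof -
    have "id \<in> young_subgroup n r" by (simp add: young_subgroup_iff permutes_id)
    then show ?thesis by blast
  qed
  fix p assume p: "p \<in> young_subgroup n r"
  then have pp: "p permutes {1..n}" by (simp add: young_subgroup_iff)
  then have "inv' p ` p ` A = A" for A
    by (simp add: image_image permutes_inverses)
  then have "inv' p \<in> young_subgroup n r"
    using p permutes_inv[OF pp] unfolding young_subgroup_iff by metis
  then show "inv\<^bsub>sym_group n\<^esub> p \<in> young_subgroup n r"
    using pp by (simp add: sym_group_carrier)
next
  fix p q assume "p \<in> young_subgroup n r" "q \<in> young_subgroup n r"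
  then show "p \<otimes>\<^bsub>sym_group n\<^esub> q \<in> young_subgroup n r"
    by (simp only: young_subgroup_iff sym_group_mult permutes_compose image_comp[symmetric] simp_thms)
qed (auto simp: young_subgroup_def)

lemma permutes_union_eq_on:
  assumes "p permutes R" "q permutes S" "R \<inter> S = {}"
  shows "x \<in> R \<Longrightarrow> (p \<circ> q) x = p x" "x \<in> S \<Longrightarrow> (p \<circ> q) x = q x"
proof -
  show "(p \<circ> q) x = p x" if "x \<in> R"
    using that assms(3) permutes_not_in[OF assms(2), of x] by (simp add: disjoint_iff)
  show "(p \<circ> q) x = q x" if "x \<in> S"
    using that assms(3) permutes_not_in[OF assms(1), of "q x"] permutes_in_image[OF assms(2), of x]
    by (metis comp_apply disjoint_iff)
qed

text \<open>A permutation preserving both blocks is in a unique way the product of a permutation of the first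
  block and a permutation of the second.\<close>

lemma card_young_subgroup:
  assumes "r \<le> n"
  shows "card (young_subgroup n r) = fact r * fact (n - r)"
proof -
  let ?R = "{1..r}" and ?S = "{r+1..n}"
  let ?P = "{p. p permutes ?R} \<times> {q. q permutes ?S}"
  let ?f = "\<lambda>(p, q). p \<circ> q"
  have RS: "?R \<union> ?S = {1..n}" "?R \<inter> ?S = {}" using assms by auto
  have "inj_on ?f ?P"
  proof (clarsimp simp: inj_on_def)
    fix p q p' q' assume a: "p permutes {Suc 0..r}" "q permutes {Suc r..n}"
      "p' permutes {Suc 0..r}" "q' permutes {Suc r..n}" "p \<circ> q = p' \<circ> q'"
    have d: "{Suc 0..r} \<inter> {Suc r..n} = {}" by auto
    have "p x = p' x" for x
      using permutes_union_eq_on(1)[OF a(1,2) d, of x] permutes_union_eq_on(1)[OF a(3,4) d, of x]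
        permutes_not_in[OF a(1), of x] permutes_not_in[OF a(3), of x] a(5)
      by (cases "x \<in> {Suc 0..r}") auto
    moreover have "q x = q' x" for x
      using permutes_union_eq_on(2)[OF a(1,2) d, of x] permutes_union_eq_on(2)[OF a(3,4) d, of x]
        permutes_not_in[OF a(2), of x] permutes_not_in[OF a(4), of x] a(5)
      by (cases "x \<in> {Suc r..n}") auto
    ultimately show "p = p' \<and> q = q'" by blast
  qed
  moreover have "?f ` ?P = young_subgroup n r"
  proof
    show "?f ` ?P \<subseteq> young_subgroup n r"
    proof clarify
      fix p q assume pq: "p permutes ?R" "q permutes ?S"
      have "p permutes {1..n}" "q permutes {1..n}"
        using permutes_subset[OF pq(1), of "{1..n}"] permutes_subset[OF pq(2), of "{1..n}"] assms by auto
      moreover have "(p \<circ> q) ` ?R = p ` ?R"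
        by (rule image_cong[OF refl permutes_union_eq_on(1)[OF pq RS(2)]])
      moreover have "(p \<circ> q) ` ?S = q ` ?S"
        by (rule image_cong[OF refl permutes_union_eq_on(2)[OF pq RS(2)]])
      ultimately show "p \<circ> q \<in> young_subgroup n r"
        using permutes_image[OF pq(1)] permutes_image[OF pq(2)]
        by (simp add: young_subgroup_iff permutes_compose)
    qed
    show "young_subgroup n r \<subseteq> ?f ` ?P"
    proof
      fix k assume "k \<in> young_subgroup n r"
      then have k: "k permutes {1..n}" "k ` ?R = ?R" "k ` ?S = ?S"
        by (auto simp: young_subgroup_iff)
      have bij: "bij_betw k ?R ?R" "bij_betw k ?S ?S"
        using k permutes_inj_on[OF k(1)] by (auto simp: bij_betw_def)
      have p: "restrict_id k ?R permutes ?R" and q: "restrict_id k ?S permutes ?S"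
        using bij by (auto intro!: permutes_restrict_id)
      have "restrict_id k ?R \<circ> restrict_id k ?S = k"
      proof
        fix x
        consider "x \<in> ?R" | "x \<in> ?S" | "x \<notin> {1..n}" using RS by blast
        then show "(restrict_id k ?R \<circ> restrict_id k ?S) x = k x"
        proof cases
          case 3
          then show ?thesis using permutes_not_in[OF k(1)] RS(1)
            by (auto simp: restrict_id_def)
        qed (use permutes_union_eq_on[OF p q RS(2)] in \<open>simp_all add: restrict_id_def\<close>)
      qed
      then show "k \<in> ?f ` ?P" using p q by (auto intro!: image_eqI[of _ _ "(restrict_id k ?R, restrict_id k ?S)"])
    qed
  qed
  ultimately have "card (young_subgroup n r) = card ?P" by (metis card_image)
  then show ?thesis by (simp add: card_cartesian_product card_permutations)
qed

lemma card_coset_space: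
  assumes "r \<le> n"
  shows "card (coset_space n r) = n choose r"
proof -
  have "card (coset_space n r) * (fact r * fact (n - r)) = fact n"
    using group.l_lagrange[OF sym_group_is_group finite_sym_group subgroup_young_subgroup, of n r]
    by (simp add: coset_space_def card_young_subgroup[OF assms] order_def)
       (simp add: sym_group_def card_permutations)
  moreover have "(n choose r) * (fact r * fact (n - r)) = (fact n :: nat)"
    using binomial_fact_lemma[OF assms] by (simp add: mult_ac)
  ultimately show ?thesis
    by (metis fact_nonzero mult_cancel2 no_zero_divisors)
qed

section \<open>One step of the walk seen through the overlap\<close>

lemma overlap_id: "overlap r id = r"
  by (simp add: overlap_def)

lemma overlap_comp_young:
  assumes "p \<in> young_subgroup n r"
  shows "overlap r (g \<circ> p) = overlap r g" "overlap r (p \<circ> g) = overlap r g"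
proof -
  have p: "p ` {1..r} = {1..r}" "inj p"
    using assms permutes_inj by (auto simp: young_subgroup_iff)
  show "overlap r (g \<circ> p) = overlap r g"
    unfolding overlap_def image_comp[symmetric] p(1) ..
  have "(p \<circ> g) ` {1..r} \<inter> {1..r} = p ` (g ` {1..r} \<inter> {1..r})"
    using p by (metis image_Int image_comp)
  then show "overlap r (p \<circ> g) = overlap r g"
    using p by (simp add: overlap_def card_image inj_on_subset)
qed

lemma transpose_image_block:
  fixes i j r n :: nat
  assumes "i \<in> {1..r}" "j \<in> {r+1..n}"
  shows "transpose i j ` {1..r} = insert j ({1..r} - {i})"
  using assms by (auto simp: transpose_def image_iff)

text \<open>Moving the transposition, which is an involution, to the other side of the intersection replaces the
  overlap of the image with the block by that of the unmoved image with the block in which \<open>j\<close> replaces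
  \<open>i\<close>.\<close>

lemma overlap_transpose:
  assumes "i \<in> {1..r}" "j \<in> {r+1..n}"
  shows "real (overlap r (transpose i j \<circ> g)) =
    real (overlap r g) - of_bool (i \<in> g ` {1..r}) + of_bool (j \<in> g ` {1..r})"
proof -
  let ?A = "g ` {1..r}" and ?t = "transpose i j"
  have "(?t \<circ> g) ` {1..r} \<inter> {1..r} = ?t ` (?A \<inter> ?t ` {1..r})"
    by (simp add: image_comp[symmetric] image_Int) (simp add: image_comp)
  then have "overlap r (?t \<circ> g) = card (?A \<inter> ?t ` {1..r})"
    unfolding overlap_def by (simp add: card_image)
  also have "?A \<inter> ?t ` {1..r} =
      (if j \<in> ?A then insert j ((?A \<inter> {1..r}) - {i}) else (?A \<inter> {1..r}) - {i})"
    unfolding transpose_image_block[OF assms] by auto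
  finally have eq: "overlap r (?t \<circ> g) = card \<dots>" .
  have j: "j \<notin> (?A \<inter> {1..r}) - {i}" using assms by auto
  have "real (card ((?A \<inter> {1..r}) - {i})) = real (overlap r g) - of_bool (i \<in> ?A)"
  proof (cases "i \<in> ?A")
    case True
    then have "i \<in> ?A \<inter> {1..r}" using assms by auto
    then have "card (?A \<inter> {1..r}) = Suc (card ((?A \<inter> {1..r}) - {i}))"
      by (intro card.remove) auto
    then show ?thesis using True by (simp add: overlap_def)
  qed (simp add: overlap_def)
  then show ?thesis using j by (simp add: eq)
qed

lemma outer_transpositions_eq:
  assumes "r \<le> n"
  shows "outer_transpositions n r = (\<lambda>(i, j). transpose i j) ` ({1..r} \<times> {r+1..n})"
proof -
  have K: "transpose i j \<in> young_subgroup n r \<longleftrightarrow> (i \<le> r \<longleftrightarrow> j \<le> r)"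
    if "i \<in> {1..n}" "j \<in> {1..n}" for i j
  proof
    assume "transpose i j \<in> young_subgroup n r"
    then have t: "transpose i j ` {1..r} = {1..r}" by (simp add: young_subgroup_iff)
    show "i \<le> r \<longleftrightarrow> j \<le> r"
    proof
      show "j \<le> r" if "i \<le> r"
        using t imageI[of i "{1..r}" "transpose i j"] that \<open>i \<in> {1..n}\<close> by auto
      show "i \<le> r" if "j \<le> r"
        using t imageI[of j "{1..r}" "transpose i j"] that \<open>j \<in> {1..n}\<close> by auto
    qed
  next
    assume "i \<le> r \<longleftrightarrow> j \<le> r"
    then have "i \<in> {1..r} \<longleftrightarrow> j \<in> {1..r}" "i \<in> {r+1..n} \<longleftrightarrow> j \<in> {r+1..n}"
      using that by auto
    then show "transpose i j \<in> young_subgroup n r"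
      using that by (simp only: young_subgroup_iff permutes_swap_id transpose_image_eq simp_thms)
  qed
  show ?thesis
  proof
    show "outer_transpositions n r \<subseteq> (\<lambda>(i, j). transpose i j) ` ({1..r} \<times> {r+1..n})"
    proof
      fix t assume "t \<in> outer_transpositions n r"
      then obtain i j where ij: "t = transpose i j" "i \<in> {1..n}" "j \<in> {1..n}"
          "t \<notin> young_subgroup n r"
        by (auto simp: outer_transpositions_def)
      then have "(i \<le> r) \<noteq> (j \<le> r)" using K by auto
      then have "(i, j) \<in> {1..r} \<times> {r+1..n} \<or> (j, i) \<in> {1..r} \<times> {r+1..n}"
        using ij by auto
      then show "t \<in> (\<lambda>(i, j). transpose i j) ` ({1..r} \<times> {r+1..n})"
        using ij(1) transpose_commute[of i j]
        by (metis (mono_tags, lifting) case_prod_conv image_eqI)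
    qed
    show "(\<lambda>(i, j). transpose i j) ` ({1..r} \<times> {r+1..n}) \<subseteq> outer_transpositions n r"
    proof clarify
      fix i j assume ij: "i \<in> {1..r}" "j \<in> {r+1..n}"
      then have "i \<in> {1..n}" "j \<in> {1..n}" "i \<noteq> j" "\<not> (i \<le> r \<longleftrightarrow> j \<le> r)"
        using assms by auto
      then show "transpose i j \<in> outer_transpositions n r"
        using K[of i j] unfolding outer_transpositions_def by blast
    qed
  qed
qed

text \<open>The factorization \<open>transpose i j \<circ> p\<close> is unique: it maps the block to the block with \<open>j\<close> in place of
  \<open>i\<close>, so this image determines \<open>i\<close> and \<open>j\<close>, and then \<open>p\<close> is obtained by cancellation. As this image
  is never the block itself, no such product lies in the subgroup.\<close>

lemma sum_walk_step:
  assumes "r \<le> n"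
  shows "(\<Sum>s\<in>carrier (sym_group n). walk_step n r s * F s) =
    ((real n)\<^sup>2 - 2 * real r * (real n - real r)) / ((real n)\<^sup>2 * fact r * fact (n - r)) *
      (\<Sum>p\<in>young_subgroup n r. F p) +
    2 / ((real n)\<^sup>2 * fact r * fact (n - r)) *
      (\<Sum>p\<in>young_subgroup n r. \<Sum>i\<in>{1..r}. \<Sum>j\<in>{r+1..n}. F (transpose i j \<circ> p))"
proof -
  let ?G = "carrier (sym_group n)" and ?K = "young_subgroup n r"
  let ?R = "{1..r}" and ?S = "{r+1..n}"
  let ?f = "\<lambda>((i, j), p). transpose i j \<circ> p"
  define T where "T = outer_transpositions n r <#>\<^bsub>sym_group n\<^esub> ?K"
  define \<alpha> where "\<alpha> = ((real n)\<^sup>2 - 2 * real r * (real n - real r)) / ((real n)\<^sup>2 * fact r * fact (n - r))"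
  define \<beta> where "\<beta> = 2 / ((real n)\<^sup>2 * fact r * fact (n - r))"
  have T: "T = ?f ` ((?R \<times> ?S) \<times> ?K)"
    unfolding T_def outer_transpositions_eq[OF assms] 
    by (fastforce simp: set_mult_def sym_group_mult image_iff)
  have img: "(transpose i j \<circ> p) ` ?R = insert j (?R - {i})"
    if "i \<in> ?R" "j \<in> ?S" "p \<in> ?K" for i j p
    using that transpose_image_block[of i r j n] by (simp only: young_subgroup_iff image_comp[symmetric])
  have unique: "i = i' \<and> j = j' \<and> p = p'"
    if a: "i \<in> ?R" "j \<in> ?S" "p \<in> ?K" "i' \<in> ?R" "j' \<in> ?S" "p' \<in> ?K"
      and eq: "transpose i j \<circ> p = transpose i' j' \<circ> p'" for i j p i' j' p'
  proof -
    have "insert j (?R - {i}) = insert j' (?R - {i'})"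
      using img[OF a(1-3)] img[OF a(4-6)] eq by simp
    then have sets: "x = j \<or> x \<in> ?R \<and> x \<noteq> i \<longleftrightarrow> x = j' \<or> x \<in> ?R \<and> x \<noteq> i'" for x
      by (auto simp: set_eq_iff)
    have "j = j'" using sets[of j] a(2) by auto
    moreover have "i = i'" using sets[of i] a(1,2,5) by auto
    moreover have "transpose i j \<circ> (transpose i j \<circ> p) = transpose i j \<circ> (transpose i j \<circ> p')"
      using eq calculation by simp
    ultimately show ?thesis
      by (simp add: comp_assoc[symmetric])
  qed
  have inj: "inj_on ?f ((?R \<times> ?S) \<times> ?K)"
  proof (rule inj_onI)
    fix x y assume "x \<in> (?R \<times> ?S) \<times> ?K" "y \<in> (?R \<times> ?S) \<times> ?K" "?f x = ?f y"
    then show "x = y"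
      using unique[of "fst (fst x)" "snd (fst x)" "snd x" "fst (fst y)" "snd (fst y)" "snd y"]
      by (simp only: mem_Times_iff case_prod_unfold prod_eq_iff simp_thms)
  qed
  have disj: "T \<inter> ?K = {}"
  proof -
    have no: False if "i \<in> ?R" "j \<in> ?S" "p \<in> ?K" "transpose i j \<circ> p \<in> ?K" for i j p
    proof -
      have "insert j (?R - {i}) = ?R" using img[OF that(1-3)] that(4) by (simp add: young_subgroup_iff)
      then have "j \<in> ?R" by blast
      then show False using that(2) by auto
    qed
    show ?thesis
    proof (rule equals0I)
      fix s assume "s \<in> T \<inter> ?K"
      then obtain i j p where "i \<in> ?R" "j \<in> ?S" "p \<in> ?K" "s = transpose i j \<circ> p" "s \<in> ?K"
        unfolding T by auto
      then show False using no by blast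
    qed
  qed
  have TG: "T \<subseteq> ?G"
  proof -
    have "transpose i j permutes {1..n}" if "i \<in> ?R" "j \<in> ?S" for i j
      using that assms by (auto intro: permutes_swap_id)
    then show ?thesis
      unfolding T by (auto simp: sym_group_carrier young_subgroup_iff intro!: permutes_compose)
  qed
  have KG: "?K \<subseteq> ?G" by (auto simp: young_subgroup_def)
  have fin: "finite T" "finite ?K" using TG KG finite_sym_group finite_subset by blast+
  have "(\<Sum>s\<in>?G. walk_step n r s * F s) = (\<Sum>s\<in>T \<union> ?K. walk_step n r s * F s)"
    by (rule sum.mono_neutral_right) (use finite_sym_group TG KG in \<open>auto simp: walk_step_def T_def\<close>)
  also have "\<dots> = (\<Sum>s\<in>T. walk_step n r s * F s) + (\<Sum>s\<in>?K. walk_step n r s * F s)"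
    using sum.union_disjoint[OF fin disj] .
  also have "(\<Sum>s\<in>?K. walk_step n r s * F s) = \<alpha> * (\<Sum>p\<in>?K. F p)"
    by (simp add: walk_step_def \<alpha>_def sum_distrib_left)
  also have "(\<Sum>s\<in>T. walk_step n r s * F s) = (\<Sum>s\<in>T. \<beta> * F s)"
  proof (rule sum.cong[OF refl])
    fix s assume "s \<in> T"
    then have "s \<notin> ?K" using disj by blast
    with \<open>s \<in> T\<close> show "walk_step n r s * F s = \<beta> * F s"
      by (simp add: walk_step_def \<beta>_def T_def)
  qed
  also have "\<dots> = \<beta> * (\<Sum>s\<in>T. F s)" by (simp add: sum_distrib_left)
  also have "(\<Sum>s\<in>T. F s) = (\<Sum>((i, j), p)\<in>(?R \<times> ?S) \<times> ?K. F (transpose i j \<circ> p))"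
    unfolding T sum.reindex[OF inj] by (rule sum.cong) auto
  also have "\<dots> = (\<Sum>ij\<in>?R \<times> ?S. \<Sum>p\<in>?K. F (transpose (fst ij) (snd ij) \<circ> p))"
    by (simp add: sum.cartesian_product case_prod_unfold)
  also have "\<dots> = (\<Sum>p\<in>?K. \<Sum>ij\<in>?R \<times> ?S. F (transpose (fst ij) (snd ij) \<circ> p))"
    by (rule sum.swap)
  also have "\<dots> = (\<Sum>p\<in>?K. \<Sum>i\<in>?R. \<Sum>j\<in>?S. F (transpose i j \<circ> p))"
    by (simp add: sum.cartesian_product case_prod_unfold)
  finally show ?thesis by (simp add: \<alpha>_def \<beta>_def)
qed

text \<open>Of the transpositions, \<open>x (n - 2r + x)\<close> take a point of the block out of the image \<open>A\<close> of the block
  (\<open>i \<in> A\<close>, \<open>j \<notin> A\<close>) and \<open>(r - x)\<^sup>2\<close> bring one in (\<open>i \<notin> A\<close>, \<open>j \<in> A\<close>); the others leave the overlap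
  unchanged.\<close>

lemma sum_swaps_overlap:
  fixes \<phi> :: "real \<Rightarrow> real"
  assumes "g permutes {1..n}" "r \<le> n"
  shows "(\<Sum>i\<in>{1..r}. \<Sum>j\<in>{r+1..n}. \<phi> (real (overlap r (transpose i j \<circ> g)))) =
    (let x = real (overlap r g) in
      real r * (real n - real r) * \<phi> x
      + x * (real n - 2 * real r + x) * (\<phi> (x - 1) - \<phi> x)
      + (real r - x)\<^sup>2 * (\<phi> (x + 1) - \<phi> x))"
proof -
  let ?A = "g ` {1..r}" and ?R = "{1..r}" and ?S = "{r+1..n}"
  define x where "x = real (overlap r g)"
  define a where "a i = (of_bool (i \<in> ?A) :: real)" for i
  have cardA: "card ?A = r" using permutes_inj[OF assms(1)] by (simp add: card_image inj_on_subset)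
  have "?A \<subseteq> {1..n}"
    using permutes_image[OF assms(1)] image_mono[of ?R "{1..n}" g] assms(2) by auto
  then have "?A = (?A \<inter> ?R) \<union> (?A \<inter> ?S)" using assms(2) by auto
  then have "r = card (?A \<inter> ?R) + card (?A \<inter> ?S)"
    using card_Un_disjoint[of "?A \<inter> ?R" "?A \<inter> ?S"] cardA by (simp add: disjoint_iff)
  then have cS: "real (card (?A \<inter> ?S)) = real r - x" and cR: "real (card (?A \<inter> ?R)) = x"
    by (auto simp: x_def overlap_def)
  have aR: "(\<Sum>i\<in>?R. a i) = x" and aS: "(\<Sum>j\<in>?S. a j) = real r - x"
    unfolding a_def of_bool_def using cR cS
    by (simp_all add: sum.If_cases Int_commute Collect_mem_eq)
  have aR': "(\<Sum>i\<in>?R. 1 - a i) = real r - x" and aS': "(\<Sum>j\<in>?S. 1 - a j) = real n - 2 * real r + x"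
    using aR aS assms(2) by (simp_all add: sum_subtractf of_nat_diff)
  have "(\<Sum>i\<in>?R. \<Sum>j\<in>?S. \<phi> (real (overlap r (transpose i j \<circ> g)))) =
     (\<Sum>i\<in>?R. \<Sum>j\<in>?S. \<phi> x + a i * (1 - a j) * (\<phi> (x - 1) - \<phi> x) + (1 - a i) * a j * (\<phi> (x + 1) - \<phi> x))"
    by (intro sum.cong refl) (auto simp: overlap_transpose a_def x_def)
  also have "\<dots> = real r * (real n - real r) * \<phi> x
      + (\<Sum>i\<in>?R. a i) * (\<Sum>j\<in>?S. 1 - a j) * (\<phi> (x - 1) - \<phi> x)
      + (\<Sum>i\<in>?R. 1 - a i) * (\<Sum>j\<in>?S. a j) * (\<phi> (x + 1) - \<phi> x)"
    unfolding sum.distrib sum_product unfolding sum_distrib_right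
    using assms(2) by (simp add: of_nat_diff)
  finally show ?thesis
    unfolding aR aS aR' aS' Let_def x_def[symmetric] by (simp add: power2_eq_square)
qed

text \<open>Since an element of the subgroup does not change the overlap, the average over \<open>p\<close> is over equal
  terms, and the overlap performs the birth-and-death step of the Bernoulli-Laplace diffusion model,
  slowed down so that it moves with probability at most \<open>2r(n - r)/n\<^sup>2\<close>.\<close>

lemma walk_step_average:
  fixes \<phi> :: "real \<Rightarrow> real"
  assumes "g permutes {1..n}" "r \<le> n" "n > 0"
  shows "(\<Sum>s\<in>carrier (sym_group n). walk_step n r s * \<phi> (real (overlap r (s \<circ> g)))) =
    (let x = real (overlap r g) in
      \<phi> x + 2 / (real n)\<^sup>2 * (x * (real n - 2 * real r + x) * (\<phi> (x - 1) - \<phi> x)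
        + (real r - x)\<^sup>2 * (\<phi> (x + 1) - \<phi> x)))"
proof -
  define x where "x = real (overlap r g)"
  define D where "D = x * (real n - 2 * real r + x) * (\<phi> (x - 1) - \<phi> x)
        + (real r - x)\<^sup>2 * (\<phi> (x + 1) - \<phi> x)"
  have 1: "(\<Sum>p\<in>young_subgroup n r. \<phi> (real (overlap r (p \<circ> g)))) = fact r * fact (n - r) * \<phi> x"
    by (simp add: overlap_comp_young x_def card_young_subgroup[OF assms(2)])
  have "(\<Sum>i\<in>{1..r}. \<Sum>j\<in>{r+1..n}. \<phi> (real (overlap r (transpose i j \<circ> p \<circ> g))))
       = real r * (real n - real r) * \<phi> x + D" if "p \<in> young_subgroup n r" for p
    using sum_swaps_overlap[OF permutes_compose[OF assms(1), of p] assms(2), of \<phi>] that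
    by (simp add: young_subgroup_iff overlap_comp_young[OF that] Let_def x_def D_def comp_assoc)
  then have 2: "(\<Sum>p\<in>young_subgroup n r. \<Sum>i\<in>{1..r}. \<Sum>j\<in>{r+1..n}.
      \<phi> (real (overlap r (transpose i j \<circ> p \<circ> g))))
     = fact r * fact (n - r) * (real r * (real n - real r) * \<phi> x + D)"
    by (simp add: card_young_subgroup[OF assms(2)])
  have "((real n)\<^sup>2 - 2 * real r * (real n - real r)) / ((real n)\<^sup>2 * f * h) * (f * h * \<phi> x)
     + 2 / ((real n)\<^sup>2 * f * h) * (f * h * (real r * (real n - real r) * \<phi> x + D))
     = \<phi> x + 2 / (real n)\<^sup>2 * D" if "f > 0" "h > 0" for f h :: real
    using that assms(3) by (simp add: field_simps)
  then show ?thesis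
    unfolding sum_walk_step[OF assms(2)] 1 2 Let_def x_def[symmetric] D_def[symmetric]
    by (metis fact_gt_zero)
qed

lemma walk_step_nonneg: "walk_step n r s \<ge> 0"
proof -
  \<comment> \<open>The probability of a step in the subgroup is a sum of two squares over the square of \<open>n\<close>.\<close>
  have "(real n)\<^sup>2 - 2 * real r * (real n - real r) = (real r)\<^sup>2 + (real n - real r)\<^sup>2"
    by (simp add: power2_eq_square algebra_simps)
  then have "(real n)\<^sup>2 - 2 * real r * (real n - real r) \<ge> 0" by simp
  then show ?thesis by (simp add: walk_step_def)
qed

section \<open>The first eigenfunction and its square\<close>

text \<open>The spherical function of the representation of dimension \<open>n - 1\<close>, as a function of the overlap. It
  is 1 at full overlap, where the walk starts.\<close>

definition eigenfunction :: "nat \<Rightarrow> nat \<Rightarrow> real \<Rightarrow> real"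
  where "eigenfunction n r x = 1 - real n * (real r - x) / (real r * (real n - real r))"

text \<open>The coefficient of the eigenfunction in the one-step average of its square. It is
  \<open>(n - 1)(n - 2)/2\<close> times the third moment of the eigenfunction under the uniform distribution, and so
  vanishes for \<open>2r = n\<close>, where complementing sets changes the sign of the eigenfunction.\<close>

definition skewness :: "nat \<Rightarrow> nat \<Rightarrow> real"
  where "skewness n r = (real n - 2 * real r)\<^sup>2 / (2 * real r * (real n - real r))"

text \<open>The drift of the overlap is affine in the overlap and vanishes at its stationary mean.\<close>

lemma step_eigenfunction:
  fixes n r :: nat and x :: real
  assumes "1 \<le> r" "r < n"
  defines "\<phi> \<equiv> eigenfunction n r"
  shows "\<phi> x + 2 / (real n)\<^sup>2 * (x * (real n - 2 * real r + x) * (\<phi> (x - 1) - \<phi> x)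
        + (real r - x)\<^sup>2 * (\<phi> (x + 1) - \<phi> x)) = (1 - 2 / real n) * \<phi> x"
proof -
  define N where "N = real n"
  define \<rho> where "\<rho> = real r"
  \<comment> \<open>The stationary mean of \<open>r - x\<close>.\<close>
  define u where "u = \<rho> * (N - \<rho>) / N"
  have pos: "N > 0" "u \<noteq> 0" using assms by (auto simp: N_def \<rho>_def u_def)
  have u: "u * N = \<rho> * (N - \<rho>)" using pos by (simp add: u_def)
  have \<phi>: "\<phi> y = 1 - (\<rho> - y) / u" for y
    using pos by (simp add: \<phi>_def eigenfunction_def u_def N_def \<rho>_def)
  have d: "\<phi> (x - 1) - \<phi> x = - (1 / u)" "\<phi> (x + 1) - \<phi> x = 1 / u"
    by (simp_all add: \<phi> diff_divide_distrib add_divide_distrib)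
  have "x * (N - 2 * \<rho> + x) * (- (1 / u)) + (\<rho> - x)\<^sup>2 * (1 / u) = ((\<rho> - x)\<^sup>2 - x * (N - 2 * \<rho> + x)) / u"
    by (simp add: diff_divide_distrib)
  also have "(\<rho> - x)\<^sup>2 - x * (N - 2 * \<rho> + x) = N * (\<rho> - x) - u * N"
    unfolding u by (simp add: power2_eq_square algebra_simps)
  also have "(N * (\<rho> - x) - u * N) / u = - (N * \<phi> x)"
    using pos by (simp add: \<phi> field_simps)
  finally have main: "x * (N - 2 * \<rho> + x) * (- (1 / u)) + (\<rho> - x)\<^sup>2 * (1 / u) = - (N * \<phi> x)" .
  show ?thesis
    unfolding d N_def[symmetric] \<rho>_def[symmetric] main using pos
    by (simp add: power2_eq_square field_simps)
qed

text \<open>The linear part of the increment of the square is governed by the drift \<open>b - a\<close>, the quadratic part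
  by the total rate \<open>a + b\<close>, and both are polynomials in the eigenfunction. The second eigenvalue of the
  walk, \<open>1 - 4(n - 1)/n\<^sup>2\<close>, equals the square of the first one.\<close>

lemma step_eigenfunction_squared:
  fixes n r :: nat and x :: real
  assumes "1 \<le> r" "r < n"
  defines "\<phi> \<equiv> \<lambda>x. (eigenfunction n r x)\<^sup>2"
  shows "\<phi> x + 2 / (real n)\<^sup>2 * (x * (real n - 2 * real r + x) * (\<phi> (x - 1) - \<phi> x)
        + (real r - x)\<^sup>2 * (\<phi> (x + 1) - \<phi> x)) =
      (1 - 2 / real n)\<^sup>2 * \<phi> x
        + 4 / (real n)\<^sup>2 * (skewness n r * eigenfunction n r x + 1)"
proof -
  define N where "N = real n"
  define \<rho> where "\<rho> = real r"
  define u where "u = \<rho> * (N - \<rho>) / N"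
  define w where "w = eigenfunction n r x"
  have pos: "N > 0" "u \<noteq> 0" using assms by (auto simp: N_def \<rho>_def u_def)
  have u: "u * N = \<rho> * (N - \<rho>)" using pos by (simp add: u_def)
  have ef: "eigenfunction n r y = 1 - (\<rho> - y) / u" for y
    using pos by (simp add: eigenfunction_def u_def N_def \<rho>_def)
  have x: "x = \<rho> - u * (1 - w)" using pos by (simp add: w_def ef)
  have nb: "eigenfunction n r (x - 1) = w - 1 / u" "eigenfunction n r (x + 1) = w + 1 / u"
    by (simp_all add: w_def ef diff_divide_distrib add_divide_distrib)
  have d: "\<phi> (x - 1) - \<phi> x = - (2 * w / u) + 1 / u\<^sup>2" "\<phi> (x + 1) - \<phi> x = 2 * w / u + 1 / u\<^sup>2"
    unfolding \<phi>_def nb w_def[symmetric]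
    by (simp_all add: power2_eq_square algebra_simps)
  have sk: "skewness n r = N / (2 * u) - 2"
  proof -
    have "skewness n r = (N - 2 * \<rho>)\<^sup>2 / (2 * (u * N))"
      unfolding skewness_def u by (simp add: N_def \<rho>_def mult.assoc)
    also have "(N - 2 * \<rho>)\<^sup>2 = N\<^sup>2 - 4 * (u * N)"
      unfolding u by (simp add: power2_eq_square algebra_simps)
    finally show ?thesis using pos by (simp add: diff_divide_distrib power2_eq_square)
  qed
  define a where "a = x * (N - 2 * \<rho> + x)"
  define b where "b = (\<rho> - x)\<^sup>2"
  have diff: "b - a = - (u * N * w)"
  proof -
    have "b - a = N * (\<rho> - x) - \<rho> * (N - \<rho>)"
      unfolding a_def b_def by (simp add: power2_eq_square algebra_simps)
    then show ?thesis unfolding u[symmetric] by (simp add: x algebra_simps)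
  qed
  have b: "b = u\<^sup>2 * (1 - w)\<^sup>2" by (simp add: b_def x power_mult_distrib)
  have tot: "a + b = u * N * w + 2 * (u\<^sup>2 * (1 - w)\<^sup>2)" using diff b by linarith
  have "a * (\<phi> (x - 1) - \<phi> x) + b * (\<phi> (x + 1) - \<phi> x) = (b - a) * (2 * w / u) + (a + b) / u\<^sup>2"
    unfolding d by (simp add: algebra_simps add_divide_distrib diff_divide_distrib)
  also have "\<dots> = - (2 * N * w\<^sup>2) + N * w / u + 2 * (1 - w)\<^sup>2"
    unfolding diff tot using pos by (simp add: field_simps power2_eq_square)
  finally have main: "a * (\<phi> (x - 1) - \<phi> x) + b * (\<phi> (x + 1) - \<phi> x)
      = - (2 * N * w\<^sup>2) + N * w / u + 2 * (1 - w)\<^sup>2" .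
  have "w\<^sup>2 + 2 / N\<^sup>2 * (- (2 * N * w\<^sup>2) + N * w / u + 2 * (1 - w)\<^sup>2) =
      (1 - 2 / N)\<^sup>2 * w\<^sup>2 + 4 / N\<^sup>2 * ((N / (2 * u) - 2) * w + 1)"
    using pos by (simp add: field_simps power2_eq_square)
  then show ?thesis
    unfolding sk N_def[symmetric] \<rho>_def[symmetric] a_def[symmetric] b_def[symmetric] main
    by (simp add: \<phi>_def w_def)
qed

section \<open>Moments of the eigenfunction under the walk and the uniform distribution\<close>

definition walk_mean :: "nat \<Rightarrow> nat \<Rightarrow> nat \<Rightarrow> (real \<Rightarrow> real) \<Rightarrow> real"
  where "walk_mean n r k \<phi> = (\<Sum>g\<in>carrier (sym_group n).
    convolution_power (sym_group n) (walk_step n r) k g * \<phi> (real (overlap r g)))"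

definition uniform_mean :: "nat \<Rightarrow> nat \<Rightarrow> (real \<Rightarrow> real) \<Rightarrow> real"
  where "uniform_mean n r \<phi> = (\<Sum>g\<in>carrier (sym_group n). 1 / fact n * \<phi> (real (overlap r g)))"

lemma walk_mean_Suc:
  assumes "r \<le> n" "n > 0"
  shows "walk_mean n r (Suc k) \<phi> = walk_mean n r k (\<lambda>x. \<phi> x + 2 / (real n)\<^sup>2 *
    (x * (real n - 2 * real r + x) * (\<phi> (x - 1) - \<phi> x) + (real r - x)\<^sup>2 * (\<phi> (x + 1) - \<phi> x)))"
  unfolding walk_mean_def convolution_power.simps
    group.sum_convolution[OF sym_group_is_group]
  using walk_step_average[OF _ assms, of _ \<phi>]
  by (intro sum.cong refl) (simp add: sym_group_carrier sym_group_mult Let_def)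

text \<open>Left multiplication by a fixed group element permutes the group, so a step of the walk preserves the
  uniform distribution.\<close>

lemma uniform_mean_stationary:
  assumes "r \<le> n" "n > 0"
  shows "uniform_mean n r \<phi> = uniform_mean n r (\<lambda>x. \<phi> x + 2 / (real n)\<^sup>2 *
    (x * (real n - 2 * real r + x) * (\<phi> (x - 1) - \<phi> x) + (real r - x)\<^sup>2 * (\<phi> (x + 1) - \<phi> x)))"
    (is "_ = uniform_mean n r ?\<psi>")
proof -
  let ?G = "carrier (sym_group n)"
  have total: "(\<Sum>s\<in>?G. walk_step n r s) = 1"
    using walk_step_average[OF permutes_id assms, of "\<lambda>_. 1"] by simp
  have "uniform_mean n r ?\<psi> =
      (\<Sum>h\<in>?G. \<Sum>s\<in>?G. walk_step n r s * (1 / fact n * \<phi> (real (overlap r (s \<circ> h)))))"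
    unfolding uniform_mean_def
  proof (rule sum.cong[OF refl])
    fix h assume "h \<in> ?G"
    then show "1 / fact n * ?\<psi> (real (overlap r h)) =
        (\<Sum>s\<in>?G. walk_step n r s * (1 / fact n * \<phi> (real (overlap r (s \<circ> h)))))"
      using walk_step_average[OF _ assms, of h \<phi>]
      by (simp add: sym_group_carrier Let_def sum_divide_distrib[symmetric])
  qed
  also have "\<dots> = (\<Sum>s\<in>?G. walk_step n r s * (\<Sum>h\<in>?G. 1 / fact n * \<phi> (real (overlap r (s \<circ> h)))))"
    by (subst sum.swap) (simp add: sum_distrib_left)
  also have "\<dots> = (\<Sum>s\<in>?G. walk_step n r s * uniform_mean n r \<phi>)"
    using group.sum_translate[OF sym_group_is_group,
        of _ n "\<lambda>g. 1 / fact n * \<phi> (real (overlap r g))"]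
    by (intro sum.cong refl) (simp add: uniform_mean_def sym_group_mult)
  also have "\<dots> = uniform_mean n r \<phi>"
    by (simp add: sum_distrib_right[symmetric] total)
  finally show ?thesis by simp
qed

lemma uniform_mean_const: "uniform_mean n r (\<lambda>_. c) = c"
  by (simp add: uniform_mean_def) (simp add: sym_group_def card_permutations)

lemma uniform_mean_linear:
  "uniform_mean n r (\<lambda>x. a * \<phi> x + b * \<psi> x) = a * uniform_mean n r \<phi> + b * uniform_mean n r \<psi>"
  by (simp add: uniform_mean_def sum.distrib sum_distrib_left algebra_simps)

lemma walk_mean_linear:
  "walk_mean n r k (\<lambda>x. a * \<phi> x + b * \<psi> x) = a * walk_mean n r k \<phi> + b * walk_mean n r k \<psi>"
  by (simp add: walk_mean_def sum.distrib sum_distrib_left algebra_simps)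

lemma walk_mean_0: "walk_mean n r 0 \<phi> = \<phi> (real r)"
proof -
  have "walk_mean n r 0 \<phi> = (\<Sum>g\<in>carrier (sym_group n). if g = id then \<phi> (real r) else 0)"
    unfolding walk_mean_def
    by (intro sum.cong refl) (auto simp: sym_group_one overlap_id)
  then show ?thesis
    by (simp add: finite_sym_group sym_group_carrier permutes_id)
qed

lemma walk_mean_one:
  assumes "r \<le> n" "n > 0"
  shows "walk_mean n r k (\<lambda>_. 1) = 1"
  by (induction k) (simp_all add: walk_mean_0 walk_mean_Suc[OF assms])

lemma walk_mean_eigenfunction:
  assumes "1 \<le> r" "r < n"
  shows "walk_mean n r k (eigenfunction n r) = (1 - 2 / real n) ^ k"
proof (induction k)
  case 0
  then show ?case by (simp add: walk_mean_0 eigenfunction_def)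
next
  case (Suc k)
  have rn: "r \<le> n" "n > 0" using assms by auto
  have "walk_mean n r (Suc k) (eigenfunction n r)
      = walk_mean n r k (\<lambda>x. (1 - 2 / real n) * eigenfunction n r x + 0 * 1)"
    unfolding walk_mean_Suc[OF rn] step_eigenfunction[OF assms(1,2)] by simp
  then show ?case unfolding walk_mean_linear by (simp add: Suc)
qed

text \<open>The recursion for the second moment is linear, with inhomogeneous terms of ratios 1 and \<open>L\<close>; the two
  fractions are the corresponding geometric sums, by \<open>1 - L\<^sup>2 = 4(n - 1)/n\<^sup>2\<close> and
  \<open>L - L\<^sup>2 = 2(n - 2)/n\<^sup>2\<close>.\<close>

lemma walk_mean_eigenfunction_squared:
  fixes n r k :: nat
  assumes "1 \<le> r" "r < n" "n \<ge> 3"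
  defines "L \<equiv> 1 - 2 / real n"
  shows "walk_mean n r k (\<lambda>x. (eigenfunction n r x)\<^sup>2) - (L ^ k)\<^sup>2 =
    (1 - (L ^ k)\<^sup>2) / (real n - 1) + 2 * skewness n r * (L ^ k - (L ^ k)\<^sup>2) / (real n - 2)"
proof (induction k)
  case 0
  then show ?case by (simp add: walk_mean_0 eigenfunction_def)
next
  case (Suc k)
  have rn: "r \<le> n" "n > 0" using assms by auto
  let ?W = "walk_mean n r k" and ?e = "eigenfunction n r" and ?\<beta> = "skewness n r"
  have "walk_mean n r (Suc k) (\<lambda>x. (?e x)\<^sup>2)
      = ?W (\<lambda>x. L\<^sup>2 * (?e x)\<^sup>2 + 4 / (real n)\<^sup>2 * (?\<beta> * ?e x + 1 * 1))"
    unfolding walk_mean_Suc[OF rn] step_eigenfunction_squared[OF assms(1,2)] by (simp add: L_def)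
  also have "\<dots> = L\<^sup>2 * ?W (\<lambda>x. (?e x)\<^sup>2) + 4 / (real n)\<^sup>2 * (?\<beta> * L ^ k + 1)"
    unfolding walk_mean_linear using assms
    by (simp add: walk_mean_eigenfunction walk_mean_one)
  also have "?W (\<lambda>x. (?e x)\<^sup>2) = (L ^ k)\<^sup>2 + (1 - (L ^ k)\<^sup>2) / (real n - 1)
      + 2 * ?\<beta> * (L ^ k - (L ^ k)\<^sup>2) / (real n - 2)"
    using Suc by linarith
  finally have step: "walk_mean n r (Suc k) (\<lambda>x. (?e x)\<^sup>2) = L\<^sup>2 * \<dots> + 4 / (real n)\<^sup>2 * (?\<beta> * L ^ k + 1)" .
  have "real n - 1 > 0" "real n - 2 > 0" "real n > 0" using assms by auto
  then have "L\<^sup>2 * (q\<^sup>2 + (1 - q\<^sup>2) / (real n - 1) + 2 * ?\<beta> * (q - q\<^sup>2) / (real n - 2))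
      + 4 / (real n)\<^sup>2 * (?\<beta> * q + 1) - (L * q)\<^sup>2
    = (1 - (L * q)\<^sup>2) / (real n - 1) + 2 * ?\<beta> * (L * q - (L * q)\<^sup>2) / (real n - 2)" for q
  proof -
    assume pos: "real n - 1 > 0" "real n - 2 > 0" "real n > 0"
    have L1: "4 / (real n)\<^sup>2 = (1 - L\<^sup>2) / (real n - 1)"
      using pos by (simp add: L_def field_simps power2_eq_square)
    have L2: "4 / (real n)\<^sup>2 = 2 * (L - L\<^sup>2) / (real n - 2)"
      using pos by (simp add: L_def field_simps power2_eq_square)
    have "4 / (real n)\<^sup>2 * (?\<beta> * q + 1) = ?\<beta> * q * (2 * (L - L\<^sup>2) / (real n - 2)) + (1 - L\<^sup>2) / (real n - 1)"
      using L1 L2 by (metis (no_types, opaque_lifting) distrib_left mult.commute mult.right_neutral)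
    then show ?thesis
      by (simp add: power_mult_distrib add_divide_distrib diff_divide_distrib algebra_simps)
  qed
  then show ?case unfolding step by simp
qed

text \<open>By stationarity the first two moments are fixed points of the one-step averages, which are linear
  equations with a unique solution.\<close>

lemma uniform_mean_eigenfunction_squared:
  assumes "1 \<le> r" "r < n" "n \<ge> 3"
  shows "uniform_mean n r (\<lambda>x. (eigenfunction n r x)\<^sup>2) = 1 / (real n - 1)"
proof -
  let ?U = "uniform_mean n r" and ?e = "eigenfunction n r" and ?L = "1 - 2 / real n"
  have rn: "r \<le> n" "n > 0" using assms by auto
  \<comment> \<open>A quantity that one step multiplies by a factor other than 1 has stationary mean 0.\<close>
  have "?U ?e = ?U (\<lambda>x. ?L * ?e x + 0 * 1)"
    by (subst uniform_mean_stationary[OF rn]) (unfold step_eigenfunction[OF assms(1,2)], simp)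
  then have "?U ?e = ?L * ?U ?e" unfolding uniform_mean_linear by simp
  then have zero: "?U ?e = 0" using assms by (simp add: field_simps)
  have "?U (\<lambda>x. (?e x)\<^sup>2)
      = ?U (\<lambda>x. ?L\<^sup>2 * (?e x)\<^sup>2 + 4 / (real n)\<^sup>2 * (skewness n r * ?e x + 1 * 1))"
    by (subst uniform_mean_stationary[OF rn]) (unfold step_eigenfunction_squared[OF assms(1,2)], simp)
  also have "\<dots> = ?L\<^sup>2 * ?U (\<lambda>x. (?e x)\<^sup>2) + 4 / (real n)\<^sup>2"
    unfolding uniform_mean_linear by (simp add: zero uniform_mean_const)
  finally have "(1 - ?L\<^sup>2) * ?U (\<lambda>x. (?e x)\<^sup>2) = 4 / (real n)\<^sup>2"
    by (simp add: algebra_simps)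
  moreover have "1 - ?L\<^sup>2 = 4 / (real n)\<^sup>2 * (real n - 1)"
    using assms by (simp add: field_simps power2_eq_square)
  ultimately have "4 / (real n)\<^sup>2 * ((real n - 1) * ?U (\<lambda>x. (?e x)\<^sup>2)) = 4 / (real n)\<^sup>2"
    by (metis mult.assoc)
  then have "(real n - 1) * ?U (\<lambda>x. (?e x)\<^sup>2) = 1" using assms by simp
  then show ?thesis using assms by (simp add: field_simps)
qed

lemma tv_dist_walk_lower_bound:
  fixes n r k :: nat
  assumes "1 \<le> r" "r < n" "n \<ge> 3"
  defines "q \<equiv> (1 - 2 / real n) ^ k"
  shows "1 - 4 / q\<^sup>2 * ((2 - q\<^sup>2) / (real n - 1) + 2 * skewness n r * (q - q\<^sup>2) / (real n - 2))
    \<le> tv_dist (coset_space n r) (walk_distribution n r k) (coset_uniform n r)"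
proof -
  let ?G = "carrier (sym_group n)" and ?e = "eigenfunction n r"
  let ?M = "convolution_power (sym_group n) (walk_step n r) k"
  let ?N = "\<lambda>g::nat\<Rightarrow>nat. 1 / fact n :: real"
  let ?F = "\<lambda>g. ?e (real (overlap r g))"
  have rn: "r \<le> n" "n > 0" using assms by auto
  have q: "q > 0" using assms by simp
  have N: "induced_measure ?N C = coset_uniform n r C" if "C \<in> coset_space n r" for C
  proof -
    have "card C = fact r * fact (n - r)"
      using group.l_card_cosets_equal[OF sym_group_is_group, of C n "young_subgroup n r"] that
        card_young_subgroup[OF rn(1)] finite_sym_group
      by (auto simp: coset_space_def young_subgroup_def)
    moreover have "real (n choose r) * (fact r * fact (n - r)) = fact n"
      using binomial_fact_lemma[OF rn(1)] by (metis mult.commute of_nat_fact of_nat_mult)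
    ultimately show ?thesis
      unfolding induced_measure_def coset_uniform_def using rn by (simp add: field_simps)
  qed
  have cong: "tv_dist (coset_space n r) \<mu> (induced_measure ?N) =
      tv_dist (coset_space n r) \<mu> (coset_uniform n r)" for \<mu>
    unfolding tv_dist_def using N by (metis (no_types, lifting) sum.cong)
  \<comment> \<open>The square is expanded into nested linear combinations of \<open>f\<^sup>2\<close>, \<open>f\<close> and 1, the form that linearity of the mean handles.\<close>
  have "(\<Sum>g\<in>?G. ?M g * (?F g - q)\<^sup>2) = walk_mean n r k (\<lambda>x. 1 * (?e x)\<^sup>2 + (- q) * (2 * ?e x + (- q) * 1))"
    unfolding walk_mean_def by (simp add: power2_eq_square algebra_simps)
  also have "\<dots> = walk_mean n r k (\<lambda>x. (?e x)\<^sup>2) - q\<^sup>2"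
    unfolding walk_mean_linear using assms rn
    by (simp add: walk_mean_eigenfunction walk_mean_one power2_eq_square algebra_simps)
  also have "\<dots> = (1 - q\<^sup>2) / (real n - 1) + 2 * skewness n r * (q - q\<^sup>2) / (real n - 2)"
    unfolding q_def by (rule walk_mean_eigenfunction_squared[OF assms(1-3)])
  finally have var: "(\<Sum>g\<in>?G. ?M g * (?F g - q)\<^sup>2) = \<dots>" .
  have var_uniform: "(\<Sum>g\<in>?G. ?N g * (?F g)\<^sup>2) = 1 / (real n - 1)"
    using uniform_mean_eigenfunction_squared[OF assms(1-3)] by (simp add: uniform_mean_def)
  have "1 - 4 / q\<^sup>2 * ((\<Sum>g\<in>?G. ?M g * (?F g - q)\<^sup>2) + (\<Sum>g\<in>?G. ?N g * (?F g)\<^sup>2))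
      \<le> tv_dist (coset_space n r) (walk_distribution n r k) (induced_measure ?N)"
    unfolding coset_space_def walk_distribution_def
  proof (rule group.tv_dist_second_moment[OF sym_group_is_group finite_sym_group subgroup_young_subgroup _ _ _ _ _ q])
    show "?M g \<ge> 0" if "g \<in> ?G" for g
      using convolution_power_nonneg[OF walk_step_nonneg that] .
    show "sum ?M ?G = 1" using walk_mean_one[OF rn, of k] by (simp add: walk_mean_def)
    show "sum ?N ?G = 1" by (simp add: sym_group_def card_permutations)
    show "?F (g \<otimes>\<^bsub>sym_group n\<^esub> h) = ?F g" if "h \<in> young_subgroup n r" for g h
      by (simp add: sym_group_mult overlap_comp_young[OF that])
  qed simp
  moreover have "(1 - q\<^sup>2) / (real n - 1) + s + 1 / (real n - 1) = (2 - q\<^sup>2) / (real n - 1) + s" for s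
    by (simp add: diff_divide_distrib add_divide_distrib)
  ultimately show ?thesis unfolding var var_uniform cong by simp
qed

section \<open>The error term at the given number of steps\<close>

lemma inverse_eigenvalue_power_le:
  assumes "n \<ge> 3"
  shows "1 / (1 - 2 / real n) ^ k \<le> exp (2 * real k / (real n - 2))"
proof -
  have "1 / (1 - 2 / real n) = 1 + 2 / (real n - 2)" using assms by (simp add: field_simps)
  also have "\<dots> \<le> exp (2 / (real n - 2))" by (rule exp_ge_add_one_self)
  finally have "(1 / (1 - 2 / real n)) ^ k \<le> exp (2 / (real n - 2)) ^ k"
    using assms by (intro power_mono) auto
  then show ?thesis by (simp add: power_divide exp_of_nat_mult[symmetric] mult_ac)
qed

text \<open>The upper bound \<open>2/(n - 2)\<close> for \<open>log (n/(n - 2))\<close> leads to \<open>n exp (- c)\<close> times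
  \<open>exp (2(log n - c)/(n - 2))\<close>. The second factor is at most \<open>exp 4\<close>, because
  \<open>log n \<le> n - 1 \<le> 2(n - 2)\<close>.\<close>

lemma inverse_squared_eigenvalue_power_le:
  assumes "n \<ge> 3" "c \<ge> 0" "real k \<le> 1/4 * real n * (ln (real n) - c)"
  shows "1 / ((1 - 2 / real n) ^ k)\<^sup>2 \<le> exp 4 * real n * exp (- c)"
proof -
  have n: "real n - 2 > 0" "real n > 0" "real n \<ge> 3" using assms by auto
  have "0 \<le> 1/4 * real n * (ln (real n) - c)" using assms(3) by linarith
  then have pos: "ln (real n) - c \<ge> 0" using n by (simp add: zero_le_mult_iff)
  have "ln (real n) \<le> real n - 1" by (rule ln_le_minus_one[OF n(2)])
  then have "ln (real n) - c \<le> 2 * (real n - 2)"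
    using assms(2) n(3) unfolding right_diff_distrib by linarith
  then have small: "2 * (ln (real n) - c) / (real n - 2) \<le> 4" using n by (simp add: divide_le_eq)
  have "1 / ((1 - 2 / real n) ^ k)\<^sup>2 = (1 / (1 - 2 / real n) ^ k)\<^sup>2" by (simp add: power_divide)
  also have "\<dots> \<le> (exp (2 * real k / (real n - 2)))\<^sup>2"
    using assms(1) by (intro power_mono inverse_eigenvalue_power_le) auto
  also have "\<dots> = exp (4 * real k / (real n - 2))"
    by (simp add: exp_double[symmetric])
  also have "4 * real k / (real n - 2) \<le> real n * (ln (real n) - c) / (real n - 2)"
    using assms(3) n by (intro divide_right_mono) auto
  also have "\<dots> = ln (real n) - c + 2 * (ln (real n) - c) / (real n - 2)"
    using n by (simp add: field_simps)
  also have "\<dots> \<le> ln (real n) - c + 4" using small by simp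
  finally have "1 / ((1 - 2 / real n) ^ k)\<^sup>2 \<le> exp (ln (real n) - c + 4)" by simp
  also have "\<dots> = exp 4 * real n * exp (- c)"
    using n by (simp add: exp_add exp_diff exp_minus field_simps)
  finally show ?thesis .
qed

text \<open>The second bound on \<open>k\<close> is chosen such that \<open>1/L\<^sup>k \<le> (N/m)\<^sup>2 (1 + (N - 2) P e\<^sup>-\<^sup>c / N\<^sup>2)\<close>, where
  \<open>m = N - 2r\<close> and \<open>P = r (N - r)\<close>. The factor \<open>(N/m)\<^sup>2\<close> may be huge for \<open>r\<close> near \<open>N/2\<close>, but it
  cancels against \<open>m\<^sup>2\<close> in the skewness. Subtracting 1 matters: it turns the contribution \<open>N\<^sup>2/(2P)\<close>,
  which is of order \<open>N\<close> for small \<open>r\<close>, into \<open>(N\<^sup>2 - m\<^sup>2)/(2P) = 2\<close>.\<close>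

lemma skewness_excess_le:
  assumes n: "n \<ge> 3" and r: "1 \<le> r" "2 * r < n"
    and k: "real k \<le> (real n - 2) * ln (real n / (real n - 2 * real r)) + 1/2 * (real n - 2) *
       ln (1 + 1/4 * (real n - 2) * (1 - ((real n - 2 * real r) / real n)\<^sup>2) * exp (- c))"
  shows "skewness n r * (1 / (1 - 2 / real n) ^ k - 1) / (real n - 2)
    \<le> 2 / (real n - 2) + 1/2 * exp (- c)"
proof -
  define N where "N = real n"
  define m where "m = N - 2 * real r"
  define P where "P = real r * (N - real r)"
  define e where "e = exp (- c)"
  have pos: "N - 2 > 0" "N > 0" "m > 0" "P > 0" "e > 0"
    using n r by (auto simp: N_def m_def P_def e_def)
  have m: "m\<^sup>2 = N\<^sup>2 - 4 * P" by (simp add: m_def P_def power2_eq_square algebra_simps)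
  have sk: "skewness n r = m\<^sup>2 / (2 * P)"
    by (simp add: skewness_def m_def P_def N_def mult.assoc)
  have s: "1/4 * (N - 2) * (1 - (m / N)\<^sup>2) * e = (N - 2) * P * e / N\<^sup>2"
    unfolding power_divide m using pos by (simp add: field_simps)
  have spos: "1 + (N - 2) * P * e / N\<^sup>2 > 0" using pos by (intro add_pos_pos) auto
  have k': "real k \<le> (N - 2) * ln (N / m) + 1/2 * (N - 2) * ln (1 + (N - 2) * P * e / N\<^sup>2)"
    using k unfolding N_def[symmetric] m_def[symmetric] e_def[symmetric] s .
  have "2 * real k / (N - 2) \<le> 2 * ((N - 2) * ln (N / m) + 1/2 * (N - 2) * ln (1 + (N - 2) * P * e / N\<^sup>2)) / (N - 2)"
    using k' pos by (intro divide_right_mono mult_left_mono) auto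
  also have "\<dots> = 2 * ln (N / m) + ln (1 + (N - 2) * P * e / N\<^sup>2)"
    using pos by (simp add: field_simps)
  finally have "exp (2 * real k / (N - 2)) \<le> exp (2 * ln (N / m) + ln (1 + (N - 2) * P * e / N\<^sup>2))"
    by simp
  also have "\<dots> = (N / m)\<^sup>2 * (1 + (N - 2) * P * e / N\<^sup>2)"
    using pos spos by (simp add: exp_add exp_double)
  finally have "1 / (1 - 2 / N) ^ k - 1 \<le> (N / m)\<^sup>2 * (1 + (N - 2) * P * e / N\<^sup>2) - 1"
    using inverse_eigenvalue_power_le[OF n, of k] unfolding N_def by linarith
  then have "skewness n r * (1 / (1 - 2 / N) ^ k - 1) / (N - 2)
      \<le> m\<^sup>2 / (2 * P) * ((N / m)\<^sup>2 * (1 + (N - 2) * P * e / N\<^sup>2) - 1) / (N - 2)"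
    unfolding sk using pos by (intro divide_right_mono mult_left_mono) auto
  also have "m\<^sup>2 / (2 * P) * ((N / m)\<^sup>2 * (1 + (N - 2) * P * e / N\<^sup>2) - 1)
      = (N\<^sup>2 * (1 + (N - 2) * P * e / N\<^sup>2) - m\<^sup>2) / (2 * P)"
    using pos by (simp add: power_divide field_simps)
  also have "\<dots> = 2 + (N - 2) * e / 2"
    unfolding m using pos by (simp add: field_simps)
  also have "\<dots> / (N - 2) = 2 / (N - 2) + 1/2 * e"
    using pos by (simp add: field_simps)
  finally show ?thesis unfolding N_def e_def .
qed

lemma second_moment_error_le:
  assumes n: "n \<ge> 3" and r: "1 \<le> r" "2 * r \<le> n" and c: "c \<ge> 0"
    and k: "ereal (real k) = step_count n r c"
  defines "q \<equiv> (1 - 2 / real n) ^ k"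
  shows "4 / q\<^sup>2 * ((2 - q\<^sup>2) / (real n - 1) + 2 * skewness n r * (q - q\<^sup>2) / (real n - 2))
    \<le> (12 * exp 4 + 52) * exp (- c)"
proof -
  have N: "real n - 2 > 0" "real n - 1 > 0" "real n > 0" using n by auto
  have q: "q > 0" using n by (simp add: q_def)
  \<comment> \<open>As \<open>k\<close> is nonnegative, this bound also forces \<open>c \<le> log n\<close>, so that terms of order \<open>1/n\<close> are at most of order \<open>exp (- c)\<close>.\<close>
  have "ereal (real k) \<le> ereal (1/4 * real n * (ln (real n) - c))"
    unfolding k step_count_def by (rule min.cobounded1)
  then have k1: "real k \<le> 1/4 * real n * (ln (real n) - c)" by simp
  have "0 \<le> 1/4 * real n * (ln (real n) - c)" using k1 by linarith
  then have "c \<le> ln (real n)" using N by (simp add: zero_le_mult_iff)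
  then have "exp (- ln (real n)) \<le> exp (- c)" by simp
  then have "1 / real n \<le> exp (- c)" using N by (simp add: exp_minus inverse_eq_divide)
  moreover have "1 / (real n - 2) \<le> 3 * (1 / real n)" using n N by (simp add: field_simps)
  ultimately have inv_n: "1 / (real n - 2) \<le> 3 * exp (- c)" by linarith
  have q2: "1 / q\<^sup>2 \<le> exp 4 * real n * exp (- c)"
    unfolding q_def by (rule inverse_squared_eigenvalue_power_le[OF n c k1])
  have "1 / q\<^sup>2 / (real n - 1) \<le> exp 4 * real n * exp (- c) / (real n - 1)"
    using q2 N by (intro divide_right_mono) auto
  also have "\<dots> = exp 4 * exp (- c) * (real n / (real n - 1))" by simp
  also have "\<dots> \<le> exp 4 * exp (- c) * (3 / 2)"
    using n by (intro mult_left_mono) (auto simp: field_simps)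
  finally have first: "1 / q\<^sup>2 / (real n - 1) \<le> 3 / 2 * exp 4 * exp (- c)" by simp
  have second: "skewness n r * (1 / q - 1) / (real n - 2) \<le> 2 / (real n - 2) + 1/2 * exp (- c)"
  proof (cases "2 * r = n")
    case True
    \<comment> \<open>The second entry of the minimum is infinite, but the skewness is 0.\<close>
    then have "real n - 2 * real r = 0" by auto
    then have "skewness n r = 0" by (simp add: skewness_def)
    then show ?thesis using N by (simp add: add_nonneg_nonneg)
  next
    case False
    then have r': "2 * r < n" using r by simp
    have "ereal (real k) \<le> ereal (real n - 2) * log_ratio n r +
     ereal ((1/2) * (real n - 2) *
       ln (1 + (1/4) * (real n - 2) * (1 - ((real n - 2 * real r) / real n)\<^sup>2) * exp (- c)))"
      unfolding k step_count_def by (rule min.cobounded2)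
    then have "real k \<le> (real n - 2) * ln (real n / (real n - 2 * real r)) + 1/2 * (real n - 2) *
       ln (1 + 1/4 * (real n - 2) * (1 - ((real n - 2 * real r) / real n)\<^sup>2) * exp (- c))"
      using False by (simp add: log_ratio_def)
    then show ?thesis unfolding q_def by (rule skewness_excess_le[OF n r(1) r'])
  qed
  have "4 / q\<^sup>2 * ((2 - q\<^sup>2) / (real n - 1) + 2 * skewness n r * (q - q\<^sup>2) / (real n - 2))
      = 8 * (1 / q\<^sup>2 / (real n - 1)) - 4 * (1 / (real n - 1))
        + 8 * (skewness n r * (1 / q - 1) / (real n - 2))"
  proof -
    have h: "(2 - q\<^sup>2) / q\<^sup>2 = 2 * (1 / q\<^sup>2) - 1" "(q - q\<^sup>2) / q\<^sup>2 = 1 / q - 1"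
      using q by (simp_all add: diff_divide_distrib power2_eq_square)
    have "4 / q\<^sup>2 * (x / a + 2 * s * y / b) = 4 * (x / q\<^sup>2) / a + 8 * s * (y / q\<^sup>2) / b"
      for x y s a b by (simp add: distrib_left)
    then have "4 / q\<^sup>2 * ((2 - q\<^sup>2) / (real n - 1) + 2 * skewness n r * (q - q\<^sup>2) / (real n - 2))
      = 4 * ((2 - q\<^sup>2) / q\<^sup>2) / (real n - 1) + 8 * skewness n r * ((q - q\<^sup>2) / q\<^sup>2) / (real n - 2)" .
    then show ?thesis unfolding h by (simp add: diff_divide_distrib)
  qed
  also have "\<dots> \<le> 8 * (3 / 2 * exp 4 * exp (- c)) + 8 * (2 / (real n - 2) + 1/2 * exp (- c))"
    using first second N by (smt (verit) zero_le_divide_1_iff)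
  also have "\<dots> \<le> 12 * exp 4 * exp (- c) + 16 * (3 * exp (- c)) + 4 * exp (- c)"
    using inv_n by simp
  finally show ?thesis by (simp add: algebra_simps)
qed

text \<open>In the constant, \<open>12 exp 4\<close> is the cost of the first bound on \<open>k\<close>, and \<open>52 = 16 * 3 + 4\<close> that
  of the second, where \<open>1/(n - 2) \<le> 3/n \<le> 3 exp (- c)\<close>.\<close>

theorem theorem2p5p5:
  shows "\<exists>a::real. a > 0 \<and>
    (\<forall>(n::nat) (r::nat) (c::real) (k::nat).
      n \<ge> 3 \<longrightarrow> 1 \<le> r \<longrightarrow> real r \<le> real n / 2 \<longrightarrow> c \<ge> 0 \<longrightarrow>
      ereal (real k) = step_count n r c \<longrightarrow>
        (1/2) * sqrt (real (n choose r)) *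
            l2_dist (coset_space n r) (walk_distribution n r k) (coset_uniform n r)
          \<ge> tv_dist (coset_space n r) (walk_distribution n r k) (coset_uniform n r) \<and>
        tv_dist (coset_space n r) (walk_distribution n r k) (coset_uniform n r)
          \<ge> 1 - a * exp (- c))"
proof (intro exI[of _ "12 * exp 4 + 52"] conjI allI impI)
  show "(12 * exp 4 + 52 :: real) > 0" by (simp add: add_pos_pos)
next
  fix n r k :: nat and c :: real
  assume n: "n \<ge> 3" and r: "1 \<le> r" "real r \<le> real n / 2" and c: "c \<ge> 0"
    and k: "ereal (real k) = step_count n r c"
  have rn: "2 * r \<le> n" "r \<le> n" "r < n" using n r by auto
  have "finite (coset_space n r)"
    by (rule card_ge_0_finite) (simp add: card_coset_space rn)
  then show "tv_dist (coset_space n r) (walk_distribution n r k) (coset_uniform n r) \<le>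
      (1/2) * sqrt (real (n choose r)) *
        l2_dist (coset_space n r) (walk_distribution n r k) (coset_uniform n r)"
    using tv_dist_le_l2_dist[of "coset_space n r"] by (simp add: card_coset_space rn)
  show "1 - (12 * exp 4 + 52) * exp (- c) \<le>
      tv_dist (coset_space n r) (walk_distribution n r k) (coset_uniform n r)"
    using tv_dist_walk_lower_bound[OF r(1) rn(3) n, of k]
      second_moment_error_le[OF n r(1) rn(1) c k] by linarith
qed

end
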